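(* For all constants $\alpha\ge1$ and $\beta\ge1$, there exists a related-machines instance with cardinality budget $\Gamma=1$ (i.e. machine speeds, intervals $[p_j^-,p_j^+]$ defining the uncertainty set $\mathcal U$ with $\Gamma=1$, and a predicted scenario $\hat q\in\mathcal U$) such that no randomized algorithm is both $\alpha$-consistent and $\beta$-robust on it; that is, there is no random schedule $\mathcal S$ with $$\mathbb E[C_{\max}(\mathcal S,\hat q)]\le\alpha\,\mathrm{OPT}(\hat q)\quad\text{and}\quad \mathbb E[C_{\max}(\mathcal S,q)]\le\beta\,\mathrm{OPT}^{\mathrm{rob}}(\mathcal U)\ \text{ for all } q\in\mathcal U.$$
   Context: There are $m$ machines and $n$ jobs. Related machines: each job $j$ has a size $p_j\ge0$, each machine $i$ has a speed $s_i>0$, and the processing time of job $j$ on machine $i$ is $q_{i,j}=p_j/s_i$; a scenario is the resulting matrix $q$. A schedule is a partition $\mathcal S=(S_1,\dots,S_m)$ of $[n]$ (parts may be empty), and $C_{\max}(\mathcal S,q)=\max_{i}\sum_{j\in S_i}q_{i,j}$. $\mathrm{OPT}(q)=\min_{\mathcal S}C_{\max}(\mathcal S,q)$ and $\mathrm{OPT}^{\mathrm{rob}}(\mathcal U)=\min_{\mathcal S}\max_{q\in\mathcal U}C_{\max}(\mathcal S,q)$, minima over deterministic schedules. Cardinality-budget uncertainty: for given $0\le p_j^-\le p_j^+$ and an integer $\Gamma\ge1$, $\mathcal U$ is the set of all scenarios obtained (with fixed speeds) from size vectors $p$ for which there is $T\subseteq[n]$ with $|T|\le\Gamma$, $p_j=p_j^-$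 for $j\notin T$ and $p_j\in[p_j^-,p_j^+]$ for $j\in T$. A randomized algorithm returns, on input $(\mathcal U,\hat q)$, a random schedule; its consistency and robustness are measured in expectation, with the scenario $q$ chosen independently of the algorithm's randomness. *)

theory Defs
  imports "HOL-Probability.Probability"
begin

text \<open>Machines are the numbers below \<open>m\<close>, jobs the numbers below \<open>n\<close>. Sizes, speeds and scenarios
  are total functions whose values outside these index ranges are never inspected.\<close>

definition schedules :: "nat \<Rightarrow> nat \<Rightarrow> (nat \<Rightarrow> nat set) set" where
  "schedules m n = {S \<in> {..<m} \<rightarrow>\<^sub>E Pow {..<n}.
     disjoint_family_on S {..<m} \<and> (\<Union>i<m. S i) = {..<n}}"

definition scenario :: "(nat \<Rightarrow> real) \<Rightarrow> (nat \<Rightarrow> real) \<Rightarrow> nat \<Rightarrow> nat \<Rightarrow> real" where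
  "scenario s p = (\<lambda>i j. p j / s i)"

definition budget_set ::
  "nat \<Rightarrow> (nat \<Rightarrow> real) \<Rightarrow> (nat \<Rightarrow> real) \<Rightarrow> (nat \<Rightarrow> real) \<Rightarrow> nat \<Rightarrow> (nat \<Rightarrow> nat \<Rightarrow> real) set" where
  "budget_set n s plo phi \<Gamma> = {scenario s p | p. \<exists>T. T \<subseteq> {..<n} \<and> card T \<le> \<Gamma> \<and>
     (\<forall>j<n. j \<notin> T \<longrightarrow> p j = plo j) \<and> (\<forall>j\<in>T. p j \<in> {plo j..phi j})}"

definition Cmax :: "nat \<Rightarrow> (nat \<Rightarrow> nat set) \<Rightarrow> (nat \<Rightarrow> nat \<Rightarrow> real) \<Rightarrow> real" where
  "Cmax m S q = (MAX i\<in>{..<m}. \<Sum>j\<in>S i. q i j)"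

definition OPT :: "nat \<Rightarrow> nat \<Rightarrow> (nat \<Rightarrow> nat \<Rightarrow> real) \<Rightarrow> real" where
  "OPT m n q = (MIN S\<in>schedules m n. Cmax m S q)"

text \<open>The inner maximum ranges over an infinite set and is written as a supremum; for budget sets
  it is attained, see \<open>Cmax_SUP_attained\<close> below.\<close>

definition OPT_rob :: "nat \<Rightarrow> nat \<Rightarrow> (nat \<Rightarrow> nat \<Rightarrow> real) set \<Rightarrow> real" where
  "OPT_rob m n U = (MIN S\<in>schedules m n. SUP q\<in>U. Cmax m S q)"

text \<open>There are finitely many schedules, so a distribution on them is a \<open>pmf\<close> without
  loss of generality.\<close>

definition random_schedule :: "nat \<Rightarrow> nat \<Rightarrow> (nat \<Rightarrow> nat set) pmf \<Rightarrow> bool" where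
  "random_schedule m n D \<longleftrightarrow> set_pmf D \<subseteq> schedules m n"

definition expected_Cmax :: "nat \<Rightarrow> (nat \<Rightarrow> nat set) pmf \<Rightarrow> (nat \<Rightarrow> nat \<Rightarrow> real) \<Rightarrow> real" where
  "expected_Cmax m D q = measure_pmf.expectation D (\<lambda>S. Cmax m S q)"

lemma finite_schedules: "finite (schedules m n)"
  unfolding schedules_def
  by (rule finite_subset[OF _ finite_PiE[of "{..<m}" "\<lambda>_. Pow {..<n}"]]) auto

lemma schedules_nonempty:
  assumes "0 < m"
  shows "schedules m n \<noteq> {}"
proof -
  have "(\<lambda>i\<in>{..<m}. if i = 0 then {..<n} else {}) \<in> schedules m n"
    using assms by (auto simp: schedules_def disjoint_family_on_def split: if_splits)
  then show ?thesis by blast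
qed

lemma Cmax_mono:
  assumes "0 < m" "S \<in> schedules m n" "\<And>i j. i < m \<Longrightarrow> j < n \<Longrightarrow> q i j \<le> q' i j"
  shows "Cmax m S q \<le> Cmax m S q'"
proof -
  have "(\<Sum>j\<in>S i. q i j) \<le> Cmax m S q'" if "i < m" for i
  proof -
    have "S i \<subseteq> {..<n}" using assms(2) that by (auto simp: schedules_def)
    then have "(\<Sum>j\<in>S i. q i j) \<le> (\<Sum>j\<in>S i. q' i j)"
      using assms(3) that by (intro sum_mono) auto
    also have "\<dots> \<le> Cmax m S q'" unfolding Cmax_def using that by (intro Max_ge) auto
    finally show ?thesis .
  qed
  then show ?thesis unfolding Cmax_def[of m S q] using assms(1) by (intro Max.boundedI) auto
qed

lemma Cmax_SUP_attained:
  assumes "0 < m" "\<forall>i<m. 0 < s i" "\<forall>j<n. 0 \<le> plo j \<and> plo j \<le> phi j" "S \<in> schedules m n"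
  shows "\<exists>q\<in>budget_set n s plo phi \<Gamma>.
    (\<forall>q'\<in>budget_set n s plo phi \<Gamma>. Cmax m S q' \<le> Cmax m S q) \<and>
    (SUP q\<in>budget_set n s plo phi \<Gamma>. Cmax m S q) = Cmax m S q"
proof -
  define e where "e T = scenario s (\<lambda>j. if j \<in> T then phi j else plo j)" for T
  define F where "F = {T. T \<subseteq> {..<n} \<and> card T \<le> \<Gamma>}"
  let ?U = "budget_set n s plo phi \<Gamma>"
  have F: "finite F" "F \<noteq> {}"
  proof -
    have "F \<subseteq> Pow {..<n}" by (auto simp: F_def)
    then show "finite F" by (rule finite_subset) simp
    have "{} \<in> F" by (simp add: F_def)
    then show "F \<noteq> {}" by blast
  qed
  have eU: "e T \<in> ?U" if "T \<in> F" for T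
  proof -
    have "\<forall>j\<in>T. j < n" using that by (auto simp: F_def)
    then show ?thesis
      using that assms(3) unfolding e_def F_def budget_set_def mem_Collect_eq
      by (intro exI[of _ "\<lambda>j. if j \<in> T then phi j else plo j"] exI[of _ T] conjI refl) auto
  qed
  have "Max ((\<lambda>T. Cmax m S (e T)) ` F) \<in> (\<lambda>T. Cmax m S (e T)) ` F"
    using F by (intro Max_in) auto
  then obtain T where T: "T \<in> F" "Max ((\<lambda>T. Cmax m S (e T)) ` F) = Cmax m S (e T)" by auto
  have le: "Cmax m S q \<le> Cmax m S (e T)" if "q \<in> ?U" for q
  proof -
    from that obtain p T' where q: "q = scenario s p" and T': "T' \<in> F"
      and p: "\<forall>j<n. j \<notin> T' \<longrightarrow> p j = plo j" "\<forall>j\<in>T'. p j \<in> {plo j..phi j}"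
      unfolding budget_set_def F_def by auto
    have "Cmax m S q \<le> Cmax m S (e T')"
      using p assms(2) by (intro Cmax_mono[OF assms(1,4)])
        (auto simp: q e_def scenario_def divide_right_mono less_imp_le)
    also have "\<dots> \<le> Cmax m S (e T)"
      unfolding T(2)[symmetric] using F T' by (intro Max_ge) auto
    finally show ?thesis .
  qed
  have "(SUP q\<in>?U. Cmax m S q) = Cmax m S (e T)"
    using eU[OF T(1)] le by (intro cSup_eq_maximum) auto
  then show ?thesis using eU[OF T(1)] le by blast
qed

end

theory Submission
  imports Defs
begin

text \<open>One machine of speed \<open>v\<close> faces \<open>k\<close> unit-speed machines, and there are \<open>k\<close> jobs with size
  interval \<open>[1, k]\<close>. When no job deviates, spreading the jobs over the slow machines costs 1, so
  if \<open>k\<close> is large compared with \<open>\<alpha> v\<close> consistency keeps at least half of the jobs (in expectation)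
  off the fast machine. A job inflated to size \<open>k\<close> costs at least \<open>k\<close> on a slow machine, whereas
  putting everything on the fast machine costs at most \<open>2 k / v\<close> in every scenario. Averaging over
  the inflated job shows that robustness fails once \<open>v\<close> is large compared with \<open>\<beta>\<close>.\<close>

lemma Cmax_ge: "i < m \<Longrightarrow> (\<Sum>j\<in>S i. q i j) \<le> Cmax m S q"
  unfolding Cmax_def by (intro Max_ge) auto

lemma Cmax_leI: "0 < m \<Longrightarrow> (\<And>i. i < m \<Longrightarrow> (\<Sum>j\<in>S i. q i j) \<le> c) \<Longrightarrow> Cmax m S q \<le> c"
  unfolding Cmax_def by (intro Max.boundedI) auto

lemma OPT_le: "S \<in> schedules m n \<Longrightarrow> OPT m n q \<le> Cmax m S q"
  unfolding OPT_def by (intro Min_le) (auto simp: finite_schedules)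

text \<open>A uniform bound on one fixed schedule suffices. Nonemptiness of \<open>U\<close> matters
  because the supremum of an empty set of reals is unspecified.\<close>

lemma OPT_rob_le:
  assumes "S \<in> schedules m n" "U \<noteq> {}" "\<And>q. q \<in> U \<Longrightarrow> Cmax m S q \<le> c"
  shows "OPT_rob m n U \<le> c"
proof -
  have "OPT_rob m n U \<le> (SUP q\<in>U. Cmax m S q)"
    unfolding OPT_rob_def using assms(1) by (intro Min_le) (auto simp: finite_schedules)
  also have "\<dots> \<le> c"
    using assms(2,3) by (intro cSUP_least)
  finally show ?thesis .
qed

lemma integrable_random_schedule:
  "random_schedule m n D \<Longrightarrow> integrable (measure_pmf D) (f :: _ \<Rightarrow> real)"
  unfolding random_schedule_def
  by (intro integrable_measure_pmf_finite finite_subset[OF _ finite_schedules])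

definition one_fast :: "real \<Rightarrow> nat \<Rightarrow> real" where
  "one_fast v i = (if i = 0 then v else 1)"

text \<open>The size vector in which job \<open>j\<close> alone deviates, to its upper end.
  Robustness is tested only against these \<open>k\<close> scenarios.\<close>

definition peak :: "nat \<Rightarrow> nat \<Rightarrow> nat \<Rightarrow> real" where
  "peak k j = (\<lambda>_. 1)(j := real k)"

lemma OPT_unit_le:
  assumes "0 < v"
  shows "OPT (Suc k) k (scenario (one_fast v) (\<lambda>_. 1)) \<le> 1"
proof -
  \<comment> \<open>Shift by one: slow machine \<open>Suc j\<close> gets exactly job
    \<open>j\<close>, and the fast machine 0 stays idle.\<close>
  define S where "S = (\<lambda>i\<in>{..<Suc k}. if i = 0 then {} else {i - 1})"
  have "S \<in> schedules (Suc k) k"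
  proof -
    have "j \<in> (\<Union>i<Suc k. S i)" if "j < k" for j
      using that by (intro UN_I[of "Suc j"]) (auto simp: S_def)
    then have "(\<Union>i<Suc k. S i) = {..<k}"
      by (auto simp: S_def split: if_splits)
    then show ?thesis
      by (auto simp: schedules_def disjoint_family_on_def S_def split: if_splits)
  qed
  moreover have "Cmax (Suc k) S (scenario (one_fast v) (\<lambda>_. 1)) \<le> 1"
    by (intro Cmax_leI) (auto simp: S_def scenario_def one_fast_def)
  ultimately show ?thesis
    using OPT_le order_trans by blast
qed

lemma OPT_rob_fast_le:
  assumes "0 < v" "0 < k"
  defines "U \<equiv> budget_set k (one_fast v) (\<lambda>_. 1) (\<lambda>_. real k) 1"
  shows "OPT_rob (Suc k) k U \<le> 2 * real k / v"
proof -
  define S where "S = (\<lambda>i\<in>{..<Suc k}. if i = 0 then {..<k} else {})"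
  have "S \<in> schedules (Suc k) k"
    by (auto simp: schedules_def disjoint_family_on_def S_def split: if_splits)
  moreover have "scenario (one_fast v) (\<lambda>_. 1) \<in> U"
    unfolding U_def budget_set_def by (auto intro!: exI[of _ "\<lambda>_. 1"] exI[of _ "{}"])
  moreover have "Cmax (Suc k) S q \<le> 2 * real k / v" if "q \<in> U" for q
  proof -
    obtain p T where q: "q = scenario (one_fast v) p" and T: "T \<subseteq> {..<k}" "card T \<le> 1"
      and p: "\<forall>j<k. j \<notin> T \<longrightarrow> p j = 1" "\<forall>j\<in>T. p j \<in> {1..real k}"
      using \<open>q \<in> U\<close> unfolding U_def budget_set_def by blast
    \<comment> \<open>Charging \<open>real k\<close> on top of the base size 1 to a deviating job is
      slightly generous, but makes the total exactly \<open>real k * (1 + card T)\<close>.\<close>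
    have "(\<Sum>j<k. p j) \<le> (\<Sum>j<k. 1 + (if j \<in> T then real k else 0))"
      using p by (intro sum_mono) auto
    also have "\<dots> = real k + real (card T) * real k"
      using T(1) by (simp add: sum.distrib sum.If_cases Int_absorb1)
    also have "\<dots> \<le> 2 * real k"
      using T(2) mult_right_mono[of "real (card T)" 1 "real k"] by simp
    finally have "(\<Sum>j<k. p j) / v \<le> 2 * real k / v"
      using assms(1) by (intro divide_right_mono) auto
    then show ?thesis
      using assms(1)
      by (intro Cmax_leI) (auto simp: S_def q scenario_def one_fast_def sum_divide_distrib)
  qed
  ultimately show ?thesis
    by (intro OPT_rob_le) auto
qed

lemma peak_in_budget_set:
  assumes "j < k"
  shows "scenario s (peak k j) \<in> budget_set k s (\<lambda>_. 1) (\<lambda>_. real k) 1"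
  unfolding budget_set_def mem_Collect_eq
  using assms by (intro exI[of _ "peak k j"] exI[of _ "{j}"]) (auto simp: peak_def)

text \<open>Off machine 0, the inflated job sits on a unit-speed machine and alone takes time
  \<open>k\<close>. The indicator turns the other case into the trivial bound 0, so that the
  inequality can be summed over all \<open>j\<close>.\<close>

lemma Cmax_peak_ge:
  assumes "S \<in> schedules (Suc k) k" "0 < v" "j < k"
  shows "real k * of_bool (j \<notin> S 0) \<le> Cmax (Suc k) S (scenario (one_fast v) (peak k j))"
proof -
  let ?q = "scenario (one_fast v) (peak k j)"
  have q0: "0 \<le> ?q i l" for i l
    using assms(2) by (auto simp: scenario_def one_fast_def peak_def)
  obtain i where i: "i < Suc k" "j \<in> S i"
    using assms(1,3) unfolding schedules_def by blast
  then have "finite (S i)"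
    using assms(1) by (auto simp: schedules_def intro: finite_subset[of _ "{..<k}"])
  then have "?q i j \<le> (\<Sum>l\<in>S i. ?q i l)"
    using i(2) q0 by (intro member_le_sum) auto
  also have "\<dots> \<le> Cmax (Suc k) S ?q"
    using i(1) by (rule Cmax_ge)
  finally have le: "?q i j \<le> Cmax (Suc k) S ?q" .
  show ?thesis
  proof (cases "j \<in> S 0")
    case True
    then show ?thesis using le q0[of i j] by simp
  next
    case False
    then have "i \<noteq> 0" using i(2) by metis
    then show ?thesis using le False by (simp add: scenario_def one_fast_def peak_def)
  qed
qed

text \<open>Each job off the fast machine costs \<open>k\<close> in its own peak scenario, so the
  right side is at least \<open>k\<close> times the number of such jobs. The load of machine 0 under
  unit sizes is \<open>card (S 0) / v\<close>, so the unit makespan limits how many jobs it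
  holds.\<close>

lemma sum_Cmax_peak_ge:
  assumes S: "S \<in> schedules (Suc k) k" and v: "0 < v"
  shows "real k * (real k - v * Cmax (Suc k) S (scenario (one_fast v) (\<lambda>_. 1)))
    \<le> (\<Sum>j<k. Cmax (Suc k) S (scenario (one_fast v) (peak k j)))"
proof -
  let ?C = "Cmax (Suc k) S (scenario (one_fast v) (\<lambda>_. 1))"
  have sub: "S 0 \<subseteq> {..<k}" using S by (auto simp: schedules_def)
  have "real (card (S 0)) / v \<le> ?C"
    using Cmax_ge[of 0 "Suc k" "scenario (one_fast v) (\<lambda>_. 1)" S]
    by (simp add: scenario_def one_fast_def)
  then have card: "real (card (S 0)) \<le> v * ?C"
    using v by (simp add: field_simps)
  have "(\<Sum>j<k. of_bool (j \<notin> S 0)) = (\<Sum>j<k. 1 - of_bool (j \<in> S 0) :: real)"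
    by (intro sum.cong) auto
  also have "\<dots> = real k - real (card (S 0))"
    using sub by (simp add: sum_subtractf Int_absorb1)
  finally have eq: "(\<Sum>j<k. of_bool (j \<notin> S 0)) = real k - real (card (S 0))" .
  have "real k * (real k - v * ?C) \<le> real k * (\<Sum>j<k. of_bool (j \<notin> S 0))"
    unfolding eq using card by (intro mult_left_mono) auto
  also have "\<dots> \<le> (\<Sum>j<k. Cmax (Suc k) S (scenario (one_fast v) (peak k j)))"
    unfolding sum_distrib_left using S v by (intro sum_mono Cmax_peak_ge) auto
  finally show ?thesis .
qed

text \<open>The bound for a single schedule is affine in the makespans, so it passes to expectations
  by linearity.\<close>

lemma sum_expected_Cmax_peak_ge:
  assumes D: "random_schedule (Suc k) k D" and v: "0 < v"
  shows "real k * (real k - v * expected_Cmax (Suc k) D (scenario (one_fast v) (\<lambda>_. 1)))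
    \<le> (\<Sum>j<k. expected_Cmax (Suc k) D (scenario (one_fast v) (peak k j)))"
proof -
  note int = integrable_random_schedule[OF D]
  have "real k * (real k - v * expected_Cmax (Suc k) D (scenario (one_fast v) (\<lambda>_. 1))) =
    measure_pmf.expectation D
      (\<lambda>S. real k * (real k - v * Cmax (Suc k) S (scenario (one_fast v) (\<lambda>_. 1))))"
    unfolding expected_Cmax_def by (simp add: int)
  also have "\<dots> \<le> measure_pmf.expectation D
      (\<lambda>S. \<Sum>j<k. Cmax (Suc k) S (scenario (one_fast v) (peak k j)))"
    using D v unfolding random_schedule_def
    by (intro integral_mono_AE int AE_pmfI sum_Cmax_peak_ge) auto
  also have "\<dots> = (\<Sum>j<k. expected_Cmax (Suc k) D (scenario (one_fast v) (peak k j)))"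
    unfolding expected_Cmax_def by (intro Bochner_Integration.integral_sum int)
  finally show ?thesis .
qed

theorem theorem9:
  fixes \<alpha> \<beta> :: real
  assumes "\<alpha> \<ge> 1" and "\<beta> \<ge> 1"
  shows "\<exists>(m :: nat) (n :: nat) (s :: nat \<Rightarrow> real) (plo :: nat \<Rightarrow> real) (phi :: nat \<Rightarrow> real)
      (qhat :: nat \<Rightarrow> nat \<Rightarrow> real).
    1 \<le> m \<and> (\<forall>i<m. 0 < s i) \<and> (\<forall>j<n. 0 \<le> plo j \<and> plo j \<le> phi j) \<and>
    qhat \<in> budget_set n s plo phi 1 \<and>
    \<not> (\<exists>D. random_schedule m n D \<and>
        expected_Cmax m D qhat \<le> \<alpha> * OPT m n qhat \<and>
        (\<forall>q \<in> budget_set n s plo phi 1.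
           expected_Cmax m D q \<le> \<beta> * OPT_rob m n (budget_set n s plo phi 1)))"
proof -
  \<comment> \<open>With this speed the robustness bound \<open>\<beta> * (2 * real k / v)\<close>
    equals \<open>real k / 4\<close>, half of the average \<open>real k / 2\<close> that consistency
    will force.\<close>
  define v where "v = 8 * \<beta>"
  have v: "0 < v" using assms by (simp add: v_def)
  \<comment> \<open>This choice gives \<open>v * \<alpha> \<le> real k / 2\<close>, so consistency
    leaves at least half of the jobs off the fast machine in expectation.\<close>
  obtain k :: nat where k: "2 * \<alpha> * v \<le> real k"
    using real_arch_simple by blast
  have "0 < 2 * \<alpha> * v" using assms v by simp
  with k have k0: "0 < k" by (cases k) auto
  let ?q = "scenario (one_fast v) (\<lambda>_. 1)"
  let ?U = "budget_set k (one_fast v) (\<lambda>_. 1) (\<lambda>_. real k) 1"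
  have False if D: "random_schedule (Suc k) k D"
    and cons: "expected_Cmax (Suc k) D ?q \<le> \<alpha> * OPT (Suc k) k ?q"
    and rob: "\<forall>q\<in>?U. expected_Cmax (Suc k) D q \<le> \<beta> * OPT_rob (Suc k) k ?U" for D
  proof -
    have "expected_Cmax (Suc k) D ?q \<le> \<alpha>"
      using cons mult_left_mono[OF OPT_unit_le[OF v, of k], of \<alpha>] assms by linarith
    then have "v * expected_Cmax (Suc k) D ?q \<le> v * \<alpha>"
      using v by (intro mult_left_mono) auto
    then have "real k / 2 \<le> real k - v * expected_Cmax (Suc k) D ?q"
      using k by (simp add: algebra_simps)
    then have "real k * (real k / 2) \<le> real k * (real k - v * expected_Cmax (Suc k) D ?q)"
      by (intro mult_left_mono) auto
    also have "\<dots> \<le> (\<Sum>j<k. expected_Cmax (Suc k) D (scenario (one_fast v) (peak k j)))"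
      using D v by (rule sum_expected_Cmax_peak_ge)
    also have "\<dots> \<le> (\<Sum>j<k. real k / 4)"
    proof (intro sum_mono)
      fix j assume "j \<in> {..<k}"
      then have "expected_Cmax (Suc k) D (scenario (one_fast v) (peak k j))
          \<le> \<beta> * OPT_rob (Suc k) k ?U"
        using rob peak_in_budget_set by auto
      also have "\<dots> \<le> \<beta> * (2 * real k / v)"
        using OPT_rob_fast_le[OF v k0] assms by (intro mult_left_mono) auto
      also have "\<dots> = real k / 4"
        using assms by (simp add: v_def)
      finally show "expected_Cmax (Suc k) D (scenario (one_fast v) (peak k j)) \<le> real k / 4" .
    qed
    \<comment> \<open>The chain reads \<open>k * (k / 2) \<le> k * (k / 4)\<close>, impossible for
      positive \<open>k\<close>.\<close>
    finally show False
      using k0 by simp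
  qed
  moreover have "?q \<in> ?U"
    unfolding budget_set_def by (auto intro!: exI[of _ "\<lambda>_. 1"] exI[of _ "{}"])
  moreover have "\<forall>i<Suc k. 0 < one_fast v i"
    using v by (simp add: one_fast_def)
  ultimately show ?thesis
    using k0
    by (intro exI[of _ "Suc k"] exI[of _ k] exI[of _ "one_fast v"] exI[of _ "\<lambda>_. 1"]
        exI[of _ "\<lambda>_. real k"] exI[of _ ?q]) auto
qed

end
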